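(* Let $n\in\{1,2,\ldots\}$ and $\beta\in(0,1)$. For each $m\in\{0,\ldots,n\}$ let $K'_m\colon\{0,\ldots,m\}\to 2^{[0,1]}$ be a $\beta$-confidence region for the binomial estimation problem with parameter $m$, i.e. $\mathrm{B}_{m,p}(\{x : p\in K'_m(x)\})\ge\beta$ for every $p\in[0,1]$. Define, for $x\in\{0,\ldots,n\}$, $$K(x):=\bigcup_{l\in\{0,\ldots,x\},\ m\in\{x-l,\ldots,n-l\}}\left(\tfrac mn K'_m(x-l)+\tfrac ln\right).$$ Then $K$ is a $\beta$-confidence region for the average success probability: $K(x)\subseteq[0,1]$ for every $x\in\{0,\ldots,n\}$, and $$\mathrm{BC}_p\big(\{x\in\{0,\ldots,n\} : \overline p\in K(x)\}\big)\ge\beta\quad\text{for every }p\in[0,1]^n .$$ Moreover $K(x)\supseteq K'_n(x)$ for every $x\in\{0,\ldots,n\}$.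
   Context: $\mathrm{B}_{m,p}$ is the binomial law with parameters $m\in\{0,1,2,\ldots\}$ and $p\in[0,1]$ (with $\mathrm{B}_{0,p}=\delta_0$). For $p=(p_1,\ldots,p_n)\in[0,1]^n$, $\mathrm{BC}_p$ is the Bernoulli convolution (Poisson-binomial law), i.e. the law of the sum of $n$ independent Bernoulli variables with success probabilities $p_1,\ldots,p_n$, and $\overline p:=\frac1n\sum_{j=1}^n p_j$. For $A\subseteq[0,1]$ and reals $s,t$, $sA+t:=\{sa+t : a\in A\}$. *)

theory Defs
  imports "HOL-Probability.Probability"
begin

text \<open>The Bernoulli convolution: the law of the sum of \<open>n\<close> independent Bernoulli variables with
  success probabilities \<open>p 1, \<dots>, p n\<close>. The value \<open>False\<close> is only what \<^const>\<open>Pi_pmf\<close> assigns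
  to indices outside \<open>{1..n}\<close>.\<close>

definition bernoulli_convolution :: "nat \<Rightarrow> (nat \<Rightarrow> real) \<Rightarrow> nat pmf" where
  "bernoulli_convolution n p =
     map_pmf (\<lambda>X. \<Sum>j = 1..n. of_bool (X j)) (Pi_pmf {1..n} False (\<lambda>j. bernoulli_pmf (p j)))"

definition average :: "nat \<Rightarrow> (nat \<Rightarrow> real) \<Rightarrow> real" where
  "average n p = (1 / real n) * (\<Sum>j = 1..n. p j)"

definition binomial_confidence_region :: "real \<Rightarrow> nat \<Rightarrow> (nat \<Rightarrow> real set) \<Rightarrow> bool" where
  "binomial_confidence_region \<beta> m K \<longleftrightarrow>
     (\<forall>x\<in>{0..m}. K x \<subseteq> {0..1}) \<and>
     (\<forall>p\<in>{0..1}. measure_pmf.prob (binomial_pmf m p) {x\<in>{0..m}. p \<in> K x} \<ge> \<beta>)"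

definition average_confidence_region :: "real \<Rightarrow> nat \<Rightarrow> (nat \<Rightarrow> real set) \<Rightarrow> bool" where
  "average_confidence_region \<beta> n K \<longleftrightarrow>
     (\<forall>x\<in>{0..n}. K x \<subseteq> {0..1}) \<and>
     (\<forall>p. (\<forall>j\<in>{1..n}. p j \<in> {0..1}) \<longrightarrow>
        measure_pmf.prob (bernoulli_convolution n p) {x\<in>{0..n}. average n p \<in> K x} \<ge> \<beta>)"

text \<open>The region \<open>K\<close> built from the family \<open>K'\<close>, where \<open>K' m x\<close> stands for $K'_m(x)$.\<close>

definition combined_region :: "nat \<Rightarrow> (nat \<Rightarrow> nat \<Rightarrow> real set) \<Rightarrow> nat \<Rightarrow> real set" where
  "combined_region n K' x =
     (\<Union>l\<in>{0..x}. \<Union>m\<in>{x - l..n - l}.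
        (\<lambda>a. (real m / real n) * a + real l / real n) ` K' m (x - l))"

end

theory Submission
  imports Defs
begin

text \<open>
  Fix \<open>p\<close> with average \<open>s\<close>, and let \<open>D\<close> be the set of observations whose region contains \<open>s\<close>.
  Once \<open>s\<close> is fixed, so is \<open>D\<close>, and what has to be bounded below is the minimum of the probability
  of \<open>D\<close> over all parameter vectors with the same sum.  Hoeffding showed that for any function \<open>h\<close>
  the minimum of the expectation of \<open>h\<close> of the number of successes, over all vectors with prescribed
  sum, is attained at a vector whose entries are \<open>0\<close>, \<open>1\<close> or one common value \<open>a\<close>
  (\<open>Hoeffding_minimum\<close>).  With \<open>l\<close> entries equal to \<open>1\<close> and \<open>m\<close> entries equal to \<open>a\<close> the number of
  successes is \<open>l\<close> plus a binomial variable with parameters \<open>m\<close> and \<open>a\<close>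
  (\<open>Hoeffding_shifted_binomial\<close>), and \<open>s = (m / n) * a + l / n\<close>.  The combined region is the union
  over exactly these shapes: an observation \<open>l + y\<close> lies in \<open>D\<close> whenever \<open>a \<in> K' m y\<close>, so the
  confidence level of \<open>K' m\<close> at \<open>a\<close> bounds the minimum from below.

  Hoeffding's theorem comes from the expectation being affine in each parameter and symmetric.  If
  all parameters except \<open>x = q i\<close> and \<open>y = q j\<close> are held fixed, it equals
  \<open>d + b * (x + y) + c * (x * y)\<close>.  At a minimum, two different parameters strictly between
  \<open>0\<close> and \<open>1\<close> force \<open>c = 0\<close>, because keeping \<open>x + y\<close> and moving the two together increases
  \<open>x * y\<close> while moving them apart decreases it.  Then both can be replaced by their mean without
  leaving the set of minimisers, which strictly decreases the sum of squares; so a minimiser with least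
  sum of squares, which exists by compactness, has the required form.
\<close>

section \<open>Expectations of functions of the number of successes\<close>

text \<open>
  The index set is arbitrary so that trials can be added one at a time, and a function \<open>h\<close> is
  used instead of an event so that a success can be absorbed into it as \<open>h \<circ> Suc\<close>.
\<close>

definition count_expectation :: "'a set \<Rightarrow> ('a \<Rightarrow> real) \<Rightarrow> (nat \<Rightarrow> real) \<Rightarrow> real" where
  "count_expectation A p h =
     measure_pmf.expectation (Pi_pmf A False (\<lambda>j. bernoulli_pmf (p j))) (\<lambda>X. h (\<Sum>j\<in>A. of_bool (X j)))"

lemma count_expectation_empty: "count_expectation {} p h = h 0"
  by (simp add: count_expectation_def)

lemma count_expectation_cong:
  assumes "\<And>j. j \<in> A \<Longrightarrow> p j = q j"
  shows "count_expectation A p h = count_expectation A q h"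
proof -
  have "Pi_pmf A False (\<lambda>j. bernoulli_pmf (p j)) = Pi_pmf A False (\<lambda>j. bernoulli_pmf (q j))"
    using assms by (intro Pi_pmf_cong) auto
  then show ?thesis by (simp add: count_expectation_def)
qed

text \<open>
  Conditioning on one trial.  All further properties of the expectation come from this recursion:
  it is affine in each parameter, continuous, and explicit when parameters are \<open>0\<close> or \<open>1\<close>.
\<close>

lemma count_expectation_insert:
  assumes "finite A" "i \<notin> A" "p i \<in> {0..1}"
  shows "count_expectation (insert i A) p h =
           p i * count_expectation A p (h \<circ> Suc) + (1 - p i) * count_expectation A p h"
proof -
  let ?P = "Pi_pmf A False (\<lambda>j. bernoulli_pmf (p j))"
  have fin: "finite (set_pmf ?P)"
    by (rule finite_subset[OF set_Pi_pmf_subset'[OF assms(1)]])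
       (use assms(1) in \<open>auto intro!: finite_PiE_dflt\<close>)
  have sums: "(\<Sum>j\<in>insert i A. of_bool ((X(i := y)) j)) = of_bool y + (\<Sum>j\<in>A. of_bool (X j) :: nat)"
    for X y
  proof -
    have "(\<Sum>j\<in>A. of_bool ((X(i := y)) j)) = (\<Sum>j\<in>A. of_bool (X j) :: nat)"
      using assms(2) by (intro sum.cong) auto
    then show ?thesis using assms(1,2) by (subst sum.insert) (simp_all only: fun_upd_same not_False_eq_True)
  qed
  have "count_expectation (insert i A) p h =
      measure_pmf.expectation (bernoulli_pmf (p i) \<bind> (\<lambda>y. map_pmf (\<lambda>X. X(i := y)) ?P))
        (\<lambda>X. h (\<Sum>j\<in>insert i A. of_bool (X j)))"
    using assms by (simp add: count_expectation_def Pi_pmf_insert' map_pmf_def)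
  also have "\<dots> = (\<Sum>y\<in>UNIV. pmf (bernoulli_pmf (p i)) y *
      measure_pmf.expectation ?P (\<lambda>X. h (of_bool y + (\<Sum>j\<in>A. of_bool (X j)))))"
    using fin
    by (subst pmf_expectation_bind[of UNIV])
       (auto simp only: finite sums real_scaleR_def integral_map_pmf
          set_map_pmf finite_imageI subset_UNIV)
  also have "\<dots> = p i * count_expectation A p (h \<circ> Suc) + (1 - p i) * count_expectation A p h"
    using assms(3) by (simp add: UNIV_bool count_expectation_def)
  finally show ?thesis .
qed

lemma continuous_on_count_expectation:
  assumes "finite A" "\<And>p j. p \<in> C \<Longrightarrow> j \<in> A \<Longrightarrow> p j \<in> {0..1}"
  shows "continuous_on C (\<lambda>p. count_expectation A p h)"
  using assms
proof (induction A arbitrary: h rule: finite_induct)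
  case empty
  show ?case by (simp add: count_expectation_empty)
next
  case (insert i A)
  have "continuous_on C (\<lambda>p. p i * count_expectation A p (h \<circ> Suc) + (1 - p i) * count_expectation A p h)"
    using insert.prems
    by (intro continuous_intros insert.IH continuous_on_subset[OF continuous_on_product_coordinates]) auto
  then show ?case
    using insert.hyps insert.prems
    by (subst continuous_on_cong[OF refl count_expectation_insert]) auto
qed

text \<open>
  Symmetry in the two trials makes the coefficients of \<open>q i\<close> and \<open>q j\<close> agree, so
  on vectors with a given sum only the product \<open>q i * q j\<close> matters.
\<close>

lemma count_expectation_two_coordinates:
  fixes h :: "nat \<Rightarrow> real"
  assumes "finite A" "i \<in> A" "j \<in> A" "i \<noteq> j"
  obtains a b c where
    "\<forall>q. (\<forall>k\<in>A - {i, j}. q k = p k) \<and> q i \<in> {0..1} \<and> q j \<in> {0..1} \<longrightarrow>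
       count_expectation A q h = a + b * (q i + q j) + c * (q i * q j)"
proof -
  define E where "E = count_expectation (A - {i, j}) p"
  show thesis
    \<comment> \<open>The coefficients are \<open>h\<close>, its first difference and its second difference, averaged over the
      other trials.\<close>
  proof (rule that[of "E h" "E (h \<circ> Suc) - E h" "E h - 2 * E (h \<circ> Suc) + E (h \<circ> Suc \<circ> Suc)"], intro allI impI)
    fix q assume "(\<forall>k\<in>A - {i, j}. q k = p k) \<and> q i \<in> {0..1} \<and> q j \<in> {0..1}"
    then have q: "\<And>k. k \<in> A - {i, j} \<Longrightarrow> q k = p k" "q i \<in> {0..1}" "q j \<in> {0..1}"
      by auto
    have E: "count_expectation (A - {i, j}) q h' = E h'" for h'
      unfolding E_def using q(1) by (rule count_expectation_cong)
    have A: "A = insert i (insert j (A - {i, j}))" using assms by auto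
    have "count_expectation A q h = 
       q i * (q j * E (h \<circ> Suc \<circ> Suc) + (1 - q j) * E (h \<circ> Suc)) +
       (1 - q i) * (q j * E (h \<circ> Suc) + (1 - q j) * E h)"
      using assms q(2,3) by (subst A) (simp add: count_expectation_insert E)
    then show "count_expectation A q h = E h + (E (h \<circ> Suc) - E h) * (q i + q j) +
        (E h - 2 * E (h \<circ> Suc) + E (h \<circ> Suc \<circ> Suc)) * (q i * q j)"
      by (simp add: algebra_simps)
  qed
qed

section \<open>Hoeffding's theorem on the minimum for a given sum of parameters\<close>

lemma sum_remove_two:
  fixes f :: "'a \<Rightarrow> real"
  assumes "finite A" "i \<in> A" "j \<in> A" "i \<noteq> j"
  shows "sum f A = f i + f j + sum f (A - {i, j})"
proof -
  have "sum f (insert i (insert j (A - {i, j}))) = f i + f j + sum f (A - {i, j})"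
    using assms by (subst sum.insert; simp)+
  moreover have "insert i (insert j (A - {i, j})) = A" using assms by auto
  ultimately show ?thesis by simp
qed

text \<open>
  Entries outside \<open>A\<close> are pinned to \<open>0\<close>; otherwise they would range over all reals and the set
  would not be compact in the product topology.
\<close>

lemma compact_unit_cube:
  "compact {p :: 'a \<Rightarrow> real. \<forall>j. p j \<in> (if j \<in> A then {0..1} else {0})}"
proof -
  have "compactin (product_topology (\<lambda>_. euclidean) UNIV) (PiE UNIV (\<lambda>j. if j \<in> A then {0..1::real} else {0}))"
    by (subst compactin_PiE) auto
  then show ?thesis by (simp add: euclidean_product_topology PiE_UNIV_domain Pi_def)
qed

lemma compact_level_set:
  fixes f :: "'a :: topological_space \<Rightarrow> real"
  assumes "compact C" "continuous_on C f"
  shows "compact {x \<in> C. f x = c}"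
  using closedin_compact[OF assms(1) continuous_closedin_preimage_constant[OF assms(2)]] .

text \<open>
  The vector \<open>q\<close> is chosen by two successive minimisations: first of the expectation, then of the sum
  of squares among the minimisers.  The second one excludes two different entries in the open
  unit interval, since averaging them would remain a minimiser with a smaller sum of squares.
\<close>

theorem Hoeffding_minimum:
  fixes p :: "'a \<Rightarrow> real"
  assumes "finite A" "\<And>j. j \<in> A \<Longrightarrow> p j \<in> {0..1}"
  obtains q a where "\<forall>j\<in>A. q j \<in> {0, a, 1}" "a \<in> {0..1}" "sum q A = sum p A"
    "count_expectation A q h \<le> count_expectation A p h"
proof -
  define U where "U = {q :: 'a \<Rightarrow> real. \<forall>j. q j \<in> (if j \<in> A then {0..1} else {0})}"
  define C where "C = {q \<in> U. sum q A = sum p A}"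
  let ?f = "\<lambda>q. count_expectation A q h"
  let ?p = "\<lambda>j. if j \<in> A then p j else 0"
  have coord: "continuous_on S (\<lambda>q :: 'a \<Rightarrow> real. q j)" for S j
    using continuous_on_product_coordinates by (rule continuous_on_subset) auto
  have in01: "q j \<in> {0..1}" if "q \<in> C" "j \<in> A" for q j
    using that by (auto simp: C_def U_def split: if_splits)
  have C: "compact C" unfolding C_def
    by (rule compact_level_set) (auto simp: U_def compact_unit_cube intro!: continuous_intros coord)
  have pC: "?p \<in> C" using assms by (auto simp: C_def U_def)
  have cont: "continuous_on C ?f"
    using assms(1) in01 by (rule continuous_on_count_expectation)
  obtain r where r: "r \<in> C" "\<And>q. q \<in> C \<Longrightarrow> ?f r \<le> ?f q"
    using continuous_attains_inf[OF C _ cont] pC by blast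
  define M where "M = {q \<in> C. ?f q = ?f r}"
  have "\<exists>q\<in>M. \<forall>q'\<in>M. (\<Sum>j\<in>A. (q j)\<^sup>2) \<le> (\<Sum>j\<in>A. (q' j)\<^sup>2)"
  proof (rule continuous_attains_inf)
    show "compact M" unfolding M_def using C cont by (rule compact_level_set)
    show "M \<noteq> {}" using r by (auto simp: M_def)
  qed (intro continuous_intros coord)
  then obtain q where q: "q \<in> M" "\<And>q'. q' \<in> M \<Longrightarrow> (\<Sum>j\<in>A. (q j)\<^sup>2) \<le> (\<Sum>j\<in>A. (q' j)\<^sup>2)"
    by blast
  have qC: "q \<in> C" and qmin: "\<And>q'. q' \<in> C \<Longrightarrow> ?f q \<le> ?f q'" using q(1) r by (auto simp: M_def)
  have not_less: False if ij: "i \<in> A" "j \<in> A" "0 < q i" "q i < q j" "q j < 1" for i j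
  proof -
    have "i \<noteq> j" using ij by auto
    define shift where "shift = (\<lambda>t. q(i := q i + t, j := q j - t))"
    have shift [simp]: "shift t i = q i + t" "shift t j = q j - t"
      "\<And>k. k \<noteq> i \<Longrightarrow> k \<noteq> j \<Longrightarrow> shift t k = q k" for t
      using \<open>i \<noteq> j\<close> by (auto simp: shift_def)
    have sum_shift: "(\<Sum>k\<in>A. g (shift t k)) =
        (\<Sum>k\<in>A. g (q k)) + (g (q i + t) - g (q i)) + (g (q j - t) - g (q j))" for g :: "real \<Rightarrow> real" and t
    proof -
      have "(\<Sum>k\<in>A - {i, j}. g (shift t k)) = (\<Sum>k\<in>A - {i, j}. g (q k))"
        by (intro sum.cong) auto
      then show ?thesis
        using sum_remove_two[OF assms(1) ij(1,2) \<open>i \<noteq> j\<close>, of "\<lambda>k. g (shift t k)"]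
          sum_remove_two[OF assms(1) ij(1,2) \<open>i \<noteq> j\<close>, of "\<lambda>k. g (q k)"] by simp
    qed
    have shiftC: "shift t \<in> C" if "q i + t \<in> {0..1}" "q j - t \<in> {0..1}" for t
    proof -
      have U: "\<And>k. q k \<in> (if k \<in> A then {0..1} else {0})" and "sum q A = sum p A"
        using qC by (auto simp: C_def U_def)
      have "shift t k \<in> (if k \<in> A then {0..1} else {0})" for k
        using U[of k] that ij(1,2) by (cases "k = i"; cases "k = j") (simp_all add: \<open>i \<noteq> j\<close>)
      moreover have "sum (shift t) A = sum p A"
        using sum_shift[of "\<lambda>x. x" t] \<open>sum q A = sum p A\<close> by simp
      ultimately show ?thesis by (simp add: C_def U_def)
    qed
    obtain a b c where abc:
      "\<forall>q'. (\<forall>k\<in>A - {i, j}. q' k = q k) \<and> q' i \<in> {0..1} \<and> q' j \<in> {0..1} \<longrightarrow>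
         ?f q' = a + b * (q' i + q' j) + c * (q' i * q' j)"
      by (rule count_expectation_two_coordinates[OF assms(1) ij(1,2) \<open>i \<noteq> j\<close>, of q h])
    have change: "?f (shift t) = ?f q + c * (t * (q j - q i - t))"
      if "q i + t \<in> {0..1}" "q j - t \<in> {0..1}" for t
      using abc[rule_format, of "shift t"] abc[rule_format, of q] that ij by (simp add: algebra_simps)
    have nonneg: "0 \<le> c * (t * (q j - q i - t))"
      if "q i + t \<in> {0..1}" "q j - t \<in> {0..1}" for t
      using qmin[OF shiftC[OF that]] change[OF that] by simp
    \<comment> \<open>The shift by \<open>s\<close> makes both entries equal; the shift by \<open>u\<close> moves them apart until
      one of them reaches \<open>0\<close> or \<open>1\<close>.  They change the product in opposite directions.\<close>
    define s where "s = (q j - q i) / 2"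
    define u where "u = - min (q i) (1 - q j)"
    have s: "q i + s \<in> {0..1}" "q j - s \<in> {0..1}" using ij by (auto simp: s_def field_simps)
    have u: "q i + u \<in> {0..1}" "q j - u \<in> {0..1}" using ij by (auto simp: u_def)
    have "q j - q i - s = s" "0 < s" using ij by (simp_all add: s_def field_simps)
    then have "s * (q j - q i - s) > 0" by simp
    with nonneg[OF s] have "0 \<le> c"
      by (meson not_le mult_neg_pos)
    moreover have "u * (q j - q i - u) < 0"
      using ij by (intro mult_neg_pos) (auto simp: u_def)
    with nonneg[OF u] have "c \<le> 0"
      by (meson not_le mult_pos_neg)
    ultimately have "c = 0" by simp
    then have "shift s \<in> M"
      using shiftC[OF s] change[OF s] q(1) by (simp add: M_def)
    from q(2)[OF this] have "0 \<le> (q i + s)\<^sup>2 - (q i)\<^sup>2 + ((q j - s)\<^sup>2 - (q j)\<^sup>2)"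
      using sum_shift[of "\<lambda>x. x\<^sup>2" s] by simp
    also have "\<dots> = - (q j - q i)\<^sup>2 / 2"
      by (simp add: s_def power2_eq_square field_simps)
    also have "\<dots> < 0" using ij by simp
    finally show False by simp
  qed
  have equal: "q i = q j" if "i \<in> A" "j \<in> A" "q i \<notin> {0, 1}" "q j \<notin> {0, 1}" for i j
  proof -
    have "0 < q i" "q i < 1" "0 < q j" "q j < 1"
      using that in01[OF qC, of i] in01[OF qC, of j] by auto
    then show ?thesis
      using not_less[of i j] not_less[of j i] that by (meson linorder_neqE_linordered_idom)
  qed
  have "\<exists>a\<in>{0..1}. \<forall>j\<in>A. q j \<in> {0, a, 1}"
  proof (cases "\<exists>i\<in>A. q i \<notin> {0, 1}")
    case True
    then obtain i where i: "i \<in> A" "q i \<notin> {0, 1}" by blast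
    have "q j \<in> {0, q i, 1}" if "j \<in> A" for j
      using equal[of i j] i that by (cases "q j \<in> {0, 1}") auto
    then show ?thesis using in01[OF qC i(1)] by blast
  next
    case False
    then show ?thesis by (intro bexI[of _ 0]) auto
  qed
  then obtain a where "a \<in> {0..1}" "\<forall>j\<in>A. q j \<in> {0, a, 1}" by blast
  moreover have "sum q A = sum p A" using qC by (simp add: C_def)
  moreover have "?f q \<le> ?f p"
    using qmin[OF pC] count_expectation_cong[of A p ?p h] by simp
  ultimately show thesis using that by blast
qed

lemma count_expectation_zeros:
  assumes "finite Z" "finite A" "Z \<inter> A = {}" "\<And>j. j \<in> Z \<Longrightarrow> p j = 0"
  shows "count_expectation (Z \<union> A) p h = count_expectation A p h"
  using assms by (induction Z rule: finite_induct) (auto simp: count_expectation_insert)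

lemma count_expectation_ones:
  assumes "finite L" "finite A" "L \<inter> A = {}" "\<And>j. j \<in> L \<Longrightarrow> p j = 1"
  shows "count_expectation (L \<union> A) p h = count_expectation A p (\<lambda>x. h (x + card L))"
  using assms
  by (induction L arbitrary: h rule: finite_induct) (auto simp: count_expectation_insert o_def)

lemma count_expectation_constant:
  assumes "finite A" "a \<in> {0..1}" "\<And>j. j \<in> A \<Longrightarrow> p j = a"
  shows "count_expectation A p h = measure_pmf.expectation (binomial_pmf (card A) a) h"
proof -
  have "(\<Sum>j\<in>A. of_bool (X j)) = card {j \<in> A. X j}" for X
    using assms(1) by (simp add: of_bool_def sum.If_cases Int_def)
  moreover have "count_expectation A p h = count_expectation A (\<lambda>_. a) h"
    using assms(3) by (rule count_expectation_cong)
  ultimately show ?thesis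
    by (simp add: count_expectation_def binomial_pmf_altdef'[OF assms(1) refl assms(2), of False])
qed

text \<open>
  At the extremal vector the sure successes contribute the shift \<open>l\<close>, the impossible ones
  contribute nothing, and the remaining \<open>m\<close> trials are identically distributed.
\<close>

corollary Hoeffding_shifted_binomial:
  fixes p :: "'a \<Rightarrow> real"
  assumes "finite A" "\<And>j. j \<in> A \<Longrightarrow> p j \<in> {0..1}"
  obtains l m a where "l + m \<le> card A" "a \<in> {0..1}" "real l + real m * a = sum p A"
    "measure_pmf.expectation (binomial_pmf m a) (\<lambda>x. h (x + l)) \<le> count_expectation A p h"
proof -
  obtain q a where q: "\<forall>j\<in>A. q j \<in> {0, a, 1}" "a \<in> {0..1}" "sum q A = sum p A"
    "count_expectation A q h \<le> count_expectation A p h"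
    using assms by (rule Hoeffding_minimum)
  define L where "L = {j \<in> A. q j = 1}"
  \<comment> \<open>If \<open>a\<close> is \<open>0\<close> or \<open>1\<close>, its trials are already counted among the impossible or sure ones, so
    \<open>M\<close> must be empty for the three sets to be disjoint.\<close>
  define M where "M = {j \<in> A. q j = a \<and> a \<noteq> 0 \<and> a \<noteq> 1}"
  define Z where "Z = {j \<in> A. q j = 0}"
  have fin: "finite L" "finite M" "finite Z" using assms(1) by (auto simp: L_def M_def Z_def)
  have disj: "L \<inter> M = {}" "Z \<inter> (L \<union> M) = {}" by (auto simp: L_def M_def Z_def)
  have A: "A = Z \<union> (L \<union> M)" using q(1) by (fastforce simp: L_def M_def Z_def)
  have "count_expectation A q h = count_expectation (L \<union> M) q h"
    unfolding A by (rule count_expectation_zeros) (use fin disj in \<open>auto simp: Z_def\<close>)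
  also have "\<dots> = count_expectation M q (\<lambda>x. h (x + card L))"
    by (rule count_expectation_ones) (use fin disj in \<open>auto simp: L_def\<close>)
  also have "\<dots> = measure_pmf.expectation (binomial_pmf (card M) a) (\<lambda>x. h (x + card L))"
    by (rule count_expectation_constant) (use fin q(2) in \<open>auto simp: M_def\<close>)
  finally have expec: "count_expectation A q h = \<dots>" .
  have "sum q A = sum q Z + (sum q L + sum q M)"
    using fin disj by (simp add: A sum.union_disjoint)
  also have "\<dots> = real (card L) + real (card M) * a"
    by (simp add: Z_def L_def M_def)
  finally have "real (card L) + real (card M) * a = sum p A" using q(3) by simp
  moreover have "card L + card M \<le> card A"
    using fin disj by (simp add: A card_Un_disjoint)
  ultimately show thesis using that[of "card L" "card M" a] q(2,4) expec by simp
qed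

section \<open>The confidence region for the average\<close>

lemma prob_bernoulli_convolution:
  "measure_pmf.prob (bernoulli_convolution n p) D = count_expectation {1..n} p (indicator D)"
proof -
  have "measure_pmf.prob (bernoulli_convolution n p) D
      = measure_pmf.expectation (bernoulli_convolution n p) (indicator D)"
    by simp
  also have "\<dots> = count_expectation {1..n} p (indicator D)"
    by (simp only: bernoulli_convolution_def count_expectation_def integral_map_pmf)
  finally show ?thesis .
qed

lemma combined_region_subset_unit:
  assumes "n \<ge> 1" "x \<le> n" "\<And>m y. m \<le> n \<Longrightarrow> y \<le> m \<Longrightarrow> K' m y \<subseteq> {0..1}"
  shows "combined_region n K' x \<subseteq> {0..1}"
proof
  fix z assume "z \<in> combined_region n K' x"
  then obtain l m a where l: "l \<le> x" and m: "x - l \<le> m" "m \<le> n - l" and a: "a \<in> K' m (x - l)"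
    and z: "z = real m / real n * a + real l / real n"
    by (auto simp: combined_region_def)
  have "m \<le> n" using m by linarith
  then have "a \<in> {0..1}" using assms(3)[of m "x - l"] m(1) a by blast
  then have "0 \<le> real m * a" "real m * a \<le> real m" by (auto intro: mult_left_le)
  moreover have "real m + real l \<le> real n" using l m assms(2) by linarith
  moreover have "z = (real m * a + real l) / real n" by (simp add: z add_divide_distrib)
  ultimately show "z \<in> {0..1}" using assms(1) by simp
qed

theorem theorem1p1:
  fixes n :: nat and \<beta> :: real and K' :: "nat \<Rightarrow> nat \<Rightarrow> real set"
  assumes "n \<ge> 1"
    and "0 < \<beta>" and "\<beta> < 1"
    and "\<And>m. m \<in> {0..n} \<Longrightarrow> binomial_confidence_region \<beta> m (K' m)"
  shows "average_confidence_region \<beta> n (combined_region n K') \<and>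
         (\<forall>x\<in>{0..n}. combined_region n K' x \<supseteq> K' n x)"
proof -
  have "combined_region n K' x \<subseteq> {0..1}" if "x \<in> {0..n}" for x
    using assms(1,4) that
    by (intro combined_region_subset_unit) (auto simp: binomial_confidence_region_def)
  moreover have "\<beta> \<le> measure_pmf.prob (bernoulli_convolution n p)
      {x\<in>{0..n}. average n p \<in> combined_region n K' x}"
    if p: "\<forall>j\<in>{1..n}. p j \<in> {0..1}" for p
  proof -
    define D where "D = {x\<in>{0..n}. average n p \<in> combined_region n K' x}"
    obtain l m a where lma: "l + m \<le> card {1..n}" "a \<in> {0..1}" "real l + real m * a = sum p {1..n}"
      and le: "measure_pmf.expectation (binomial_pmf m a) (\<lambda>x. indicator D (x + l))
        \<le> count_expectation {1..n} p (indicator D)"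
      by (rule Hoeffding_shifted_binomial[of "{1..n}" p "indicator D"]) (use p in auto)
    have lm: "l + m \<le> n" using lma(1) by simp
    have avg: "average n p = real m / real n * a + real l / real n"
      unfolding average_def lma(3)[symmetric] by (simp add: add_divide_distrib)
    \<comment> \<open>The observation \<open>y + l\<close> picks the member of the union with these \<open>l\<close> and \<open>m\<close>, whose image of
      \<open>a\<close> is the average of \<open>p\<close>.\<close>
    have sub: "{y\<in>{0..m}. a \<in> K' m y} \<subseteq> {y. y + l \<in> D}"
    proof
      fix y assume y: "y \<in> {y\<in>{0..m}. a \<in> K' m y}"
      then have "average n p \<in> combined_region n K' (y + l)"
        unfolding combined_region_def avg using lm
        by (intro UN_I[of l] UN_I[of m] imageI) auto
      then show "y \<in> {y. y + l \<in> D}" using y lm by (simp add: D_def)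
    qed
    have "\<beta> \<le> measure_pmf.prob (binomial_pmf m a) {y\<in>{0..m}. a \<in> K' m y}"
      using assms(4)[of m] lm lma(2) by (simp add: binomial_confidence_region_def)
    also have "\<dots> \<le> measure_pmf.prob (binomial_pmf m a) {y. y + l \<in> D}"
      using sub by (intro measure_pmf.finite_measure_mono) auto
    also have "\<dots> = measure_pmf.expectation (binomial_pmf m a) (indicator {y. y + l \<in> D})"
      by simp
    also have "\<dots> = measure_pmf.expectation (binomial_pmf m a) (\<lambda>x. indicator D (x + l))"
      by (intro Bochner_Integration.integral_cong) (auto simp: indicator_def)
    also note le
    finally show ?thesis by (simp add: prob_bernoulli_convolution D_def)
  qed
  \<comment> \<open>\<open>K' n x\<close> is the member of the union with \<open>l = 0\<close> and \<open>m = n\<close>.\<close>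
  moreover have "K' n x \<subseteq> combined_region n K' x" if "x \<in> {0..n}" for x
  proof
    fix a assume "a \<in> K' n x"
    then have "real n / real n * a + real 0 / real n \<in> combined_region n K' x"
      unfolding combined_region_def using that
      by (intro UN_I[of 0] UN_I[of n] imageI) auto
    then show "a \<in> combined_region n K' x" using assms(1) by simp
  qed
  ultimately show ?thesis unfolding average_confidence_region_def by blast
qed

end
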